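(* Let $K$ be a field, let $k\ge 2$ be an integer, and let $a,d\in\mathbb{N}^2$ be linearly independent over $\mathbb{Q}$ such that $\{a,a+d,\ldots,a+kd\}$ is a minimal generating set of $S_{a,d,k}=\langle a,a+d,\ldots,a+kd\rangle$. Then, with respect to the (graded) reverse lexicographic order on $K[x_1,\ldots,x_{k+1}]$ with $x_1>x_2>\cdots>x_{k+1}$, the set $G=\bigcup_{\ell=2}^{k}\xi_\ell$ is a Gröbner basis of the defining ideal $I_{S_{a,d,k}}$ of $K[S_{a,d,k}]$, where for $\ell\in\{2,\ldots,k\}$ the set $\xi_\ell$ is defined as follows. If $2\ell>k+1$, then $$\xi_\ell=\{x_\ell^2-x_{2\ell-k-1}x_{k+1}\}\cup\{x_\ell x_{\ell+i}-x_{2\ell-k-1+i}x_{k+1}\mid 1\le i\le k-\ell\}.$$ If $2\ell\le k+1$, then $$\xi_\ell=\{x_\ell^2-x_1x_{2\ell-1}\}\cup\{x_\ell x_{\ell+i}-x_1x_{2\ell-1+i}\mid 1\le i\le k-2\ell+2\}\cup\{x_\ell x_{\ell+i}-x_{2\ell-k-1+i}x_{k+1}\mid k-2\ell+2<i\le k-\ell\}.$$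
   Context: $\mathbb{N}$ denotes the set of non-negative integers. $\langle a_1,\ldots,a_n\rangle=\{\sum_i\lambda_i a_i\mid \lambda_i\in\mathbb{N}\}$ is the affine semigroup generated by $a_1,\ldots,a_n\in\mathbb{N}^r$. $K[S]=\bigoplus_{s\in S}K\mathbf{t}^s\subseteq K[t_1,\ldots,t_r]$ is the semigroup ring of $S$. The defining ideal $I_{S_{a,d,k}}$ is the kernel of the $K$-algebra homomorphism $K[x_1,\ldots,x_{k+1}]\to K[S_{a,d,k}]$, $x_i\mapsto\mathbf{t}^{a+(i-1)d}$. A finite subset $G=\{g_1,\ldots,g_t\}$ of an ideal $I$ is a Gröbner basis of $I$ if $\langle \mathrm{LT}(g_1),\ldots,\mathrm{LT}(g_t)\rangle=\langle\mathrm{LT}(I)\rangle$, where $\mathrm{LT}$ denotes the leading term. *)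

theory Defs
  imports
    Complex_Main
    "HOL-Library.Poly_Mapping"
    "HOL-Library.Product_Plus"
    "HOL-Algebra.RingHom"
begin

section \<open>Affine semigroups\<close>

text \<open>Vectors of \<open>\<nat>\<^sup>2\<close> are pairs, with componentwise addition.\<close>

definition nscale :: "nat \<Rightarrow> nat \<times> nat \<Rightarrow> nat \<times> nat"
  where "nscale n v = (n * fst v, n * snd v)"

text \<open>Meant for finite \<open>A\<close>.\<close>

definition affine_semigroup :: "(nat \<times> nat) set \<Rightarrow> (nat \<times> nat) set"
  where "affine_semigroup A = {\<Sum>v\<in>A. nscale (c v) v | c. True}"

definition minimal_generating_set :: "(nat \<times> nat) set \<Rightarrow> (nat \<times> nat) set \<Rightarrow> bool"
  where "minimal_generating_set A S \<longleftrightarrow>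
    affine_semigroup A = S \<and> (\<forall>B. B \<subset> A \<longrightarrow> affine_semigroup B \<noteq> S)"

definition lin_indep_rat :: "nat \<times> nat \<Rightarrow> nat \<times> nat \<Rightarrow> bool"
  where "lin_indep_rat a d \<longleftrightarrow> (\<forall>p q :: rat.
    p * of_nat (fst a) + q * of_nat (fst d) = 0 \<and>
    p * of_nat (snd a) + q * of_nat (snd d) = 0 \<longrightarrow> p = 0 \<and> q = 0)"

definition generators :: "nat \<times> nat \<Rightarrow> nat \<times> nat \<Rightarrow> nat \<Rightarrow> (nat \<times> nat) set"
  where "generators a d k = (\<lambda>i. a + nscale i d) ` {0..k}"

definition S_adk :: "nat \<times> nat \<Rightarrow> nat \<times> nat \<Rightarrow> nat \<Rightarrow> (nat \<times> nat) set"
  where "S_adk a d k = affine_semigroup (generators a d k)"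

section \<open>Semigroup rings and polynomial rings\<close>

text \<open>The type \<open>'m \<Rightarrow>\<^sub>0 'k\<close> carries the convolution product, so it is the monoid ring of \<open>'m\<close>:
  \<open>Poly_Mapping.single m c\<close> is the term \<open>c t\<^sup>m\<close>. Restricting the supports to a submonoid \<open>M\<close>
  gives the subring \<open>K[M] = \<Oplus>\<^sub>m\<^sub>\<in>\<^sub>M K t\<^sup>m\<close>.\<close>

definition semigroup_ring :: "'m::comm_monoid_add set \<Rightarrow> ('m \<Rightarrow>\<^sub>0 'k::field) ring"
  where "semigroup_ring M =
    \<lparr>carrier = {f. Poly_Mapping.keys f \<subseteq> M}, mult = (*), one = 1, zero = 0, add = (+)\<rparr>"

text \<open>\<open>K[x\<^sub>1, \<dots>, x\<^sub>n]\<close> is the monoid ring of the exponent vectors supported in \<open>{1..n}\<close>.\<close>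

definition exponents :: "nat \<Rightarrow> (nat \<Rightarrow>\<^sub>0 nat) set"
  where "exponents n = {m. Poly_Mapping.keys m \<subseteq> {1..n}}"

abbreviation poly_ring :: "nat \<Rightarrow> ((nat \<Rightarrow>\<^sub>0 nat) \<Rightarrow>\<^sub>0 'k::field) ring"
  where "poly_ring n \<equiv> semigroup_ring (exponents n)"

definition X :: "nat \<Rightarrow> (nat \<Rightarrow>\<^sub>0 nat) \<Rightarrow>\<^sub>0 'k::field"
  where "X i = Poly_Mapping.single (Poly_Mapping.single i 1) 1"

text \<open>The \<open>K\<close>-algebra homomorphism with \<open>x\<^sub>i \<mapsto> h i\<close>.\<close>

definition subst_hom ::
    "(nat \<Rightarrow> 'm::comm_monoid_add \<Rightarrow>\<^sub>0 'k::field) \<Rightarrow> ((nat \<Rightarrow>\<^sub>0 nat) \<Rightarrow>\<^sub>0 'k) \<Rightarrow> 'm \<Rightarrow>\<^sub>0 'k"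
  where "subst_hom h f = (\<Sum>m\<in>Poly_Mapping.keys f.
    Poly_Mapping.single 0 (Poly_Mapping.lookup f m) *
    (\<Prod>i\<in>Poly_Mapping.keys m. h i ^ Poly_Mapping.lookup m i))"

definition \<phi> ::
    "nat \<times> nat \<Rightarrow> nat \<times> nat \<Rightarrow> ((nat \<Rightarrow>\<^sub>0 nat) \<Rightarrow>\<^sub>0 'k::field) \<Rightarrow> (nat \<times> nat) \<Rightarrow>\<^sub>0 'k"
  where "\<phi> a d = subst_hom (\<lambda>i. Poly_Mapping.single (a + nscale (i - 1) d) 1)"

definition defining_ideal ::
    "nat \<times> nat \<Rightarrow> nat \<times> nat \<Rightarrow> nat \<Rightarrow> ((nat \<Rightarrow>\<^sub>0 nat) \<Rightarrow>\<^sub>0 'k::field) set"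
  where "defining_ideal a d k =
    a_kernel (poly_ring (k + 1)) (semigroup_ring (S_adk a d k)) (\<phi> a d)"

section \<open>Leading terms and Groebner bases\<close>

definition tdeg :: "(nat \<Rightarrow>\<^sub>0 nat) \<Rightarrow> nat"
  where "tdeg m = (\<Sum>i\<in>Poly_Mapping.keys m. Poly_Mapping.lookup m i)"

text \<open>Graded reverse lexicographic order with \<open>x\<^sub>1 > x\<^sub>2 > \<dots>\<close>: ties in the total degree are
  broken by the last exponent that differs, the monomial with the larger one being smaller.\<close>

definition grevlex :: "(nat \<Rightarrow>\<^sub>0 nat) \<Rightarrow> (nat \<Rightarrow>\<^sub>0 nat) \<Rightarrow> bool"
  where "grevlex m n \<longleftrightarrow> tdeg m < tdeg n \<or>
    (tdeg m = tdeg n \<and>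
      (\<exists>i. Poly_Mapping.lookup n i < Poly_Mapping.lookup m i \<and>
        (\<forall>j>i. Poly_Mapping.lookup m j = Poly_Mapping.lookup n j)))"

text \<open>In the next definitions \<open>lt\<close> is a strict monomial order.\<close>

definition lead_monomial ::
    "('m \<Rightarrow> 'm \<Rightarrow> bool) \<Rightarrow> ('m \<Rightarrow>\<^sub>0 'k::zero) \<Rightarrow> 'm"
  where "lead_monomial lt f =
    (THE m. m \<in> Poly_Mapping.keys f \<and> (\<forall>n\<in>Poly_Mapping.keys f. n \<noteq> m \<longrightarrow> lt n m))"

definition LT :: "('m \<Rightarrow> 'm \<Rightarrow> bool) \<Rightarrow> ('m \<Rightarrow>\<^sub>0 'k::zero) \<Rightarrow> 'm \<Rightarrow>\<^sub>0 'k"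
  where "LT lt f = (if f = 0 then 0 else
    Poly_Mapping.single (lead_monomial lt f) (Poly_Mapping.lookup f (lead_monomial lt f)))"

definition groebner_basis ::
    "((nat \<Rightarrow>\<^sub>0 nat) \<Rightarrow> (nat \<Rightarrow>\<^sub>0 nat) \<Rightarrow> bool) \<Rightarrow> nat \<Rightarrow> ((nat \<Rightarrow>\<^sub>0 nat) \<Rightarrow>\<^sub>0 'k::field) set \<Rightarrow>
      ((nat \<Rightarrow>\<^sub>0 nat) \<Rightarrow>\<^sub>0 'k) set \<Rightarrow> bool"
  where "groebner_basis lt n I G \<longleftrightarrow>
    ideal I (poly_ring n) \<and> finite G \<and> G \<subseteq> I \<and>
    Idl\<^bsub>poly_ring n\<^esub> (LT lt ` G) = Idl\<^bsub>poly_ring n\<^esub> (LT lt ` I)"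

section \<open>The sets of binomials\<close>

text \<open>Subtractions are arranged so that they never truncate in the stated index ranges:
  \<open>2\<ell>-k-1+i\<close> is written \<open>2 * l + i - (k + 1)\<close>, since \<open>2\<ell>-k-1\<close> alone may be negative.\<close>

definition xi :: "nat \<Rightarrow> nat \<Rightarrow> ((nat \<Rightarrow>\<^sub>0 nat) \<Rightarrow>\<^sub>0 'k::field) set"
  where "xi k l =
    (if 2 * l > k + 1 then
       {X l ^ 2 - X (2 * l - (k + 1)) * X (k + 1)} \<union>
       {X l * X (l + i) - X (2 * l + i - (k + 1)) * X (k + 1) | i. 1 \<le> i \<and> i \<le> k - l}
     else
       {X l ^ 2 - X 1 * X (2 * l - 1)} \<union>
       {X l * X (l + i) - X 1 * X (2 * l - 1 + i) | i. 1 \<le> i \<and> i \<le> k + 2 - 2 * l} \<union>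
       {X l * X (l + i) - X (2 * l + i - (k + 1)) * X (k + 1) | i.
         k + 2 - 2 * l < i \<and> i \<le> k - l})"

section \<open>Well-definedness\<close>

text \<open>The rings are commutative rings, \<open>\<phi>\<close> is a ring homomorphism fixing \<open>K\<close> with the prescribed
  values on the variables, \<open>grevlex\<close> is a strict total order compatible with addition and with
  least element \<open>0\<close>, and leading monomials exist.\<close>

lemma pm_expand: "f = (\<Sum>m\<in>Poly_Mapping.keys f. Poly_Mapping.single m (Poly_Mapping.lookup f m))"
  by (rule poly_mapping_eqI)
    (auto simp: lookup_sum lookup_single when_def in_keys_iff if_distrib cong: if_cong)

lemma semigroup_ring_cring:
  assumes "0 \<in> M" "\<And>x y. x \<in> M \<Longrightarrow> y \<in> M \<Longrightarrow> x + y \<in> M"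
  shows "cring (semigroup_ring M :: ('m::comm_monoid_add \<Rightarrow>\<^sub>0 'k::field) ring)"
proof -
  have mult: "Poly_Mapping.keys (f * g) \<subseteq> M" if "Poly_Mapping.keys f \<subseteq> M" "Poly_Mapping.keys g \<subseteq> M"
    for f g :: "'m \<Rightarrow>\<^sub>0 'k"
    using keys_mult[of f g] that assms(2) by blast
  have add: "Poly_Mapping.keys (f + g) \<subseteq> M" if "Poly_Mapping.keys f \<subseteq> M" "Poly_Mapping.keys g \<subseteq> M"
    for f g :: "'m \<Rightarrow>\<^sub>0 'k"
    using keys_add[of f g] that by blast
  have neg: "Poly_Mapping.keys (- f) = Poly_Mapping.keys f" for f :: "'m \<Rightarrow>\<^sub>0 'k"
    by (auto simp: in_keys_iff)
  show ?thesis
    apply (rule cringI)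
      apply (rule abelian_groupI)
    apply (auto simp: semigroup_ring_def algebra_simps assms(1) intro: mult[THEN subsetD] add[THEN subsetD])
    subgoal for f by (rule exI[of _ "-f"]) (auto simp: neg)
    apply (rule comm_monoidI)
    apply (auto simp: semigroup_ring_def algebra_simps assms(1) intro: mult[THEN subsetD] add[THEN subsetD])
    done
qed

lemma subst_hom_superset:
  assumes "finite A" "Poly_Mapping.keys f \<subseteq> A"
  shows "subst_hom h f = (\<Sum>m\<in>A. Poly_Mapping.single 0 (Poly_Mapping.lookup f m) *
    (\<Prod>i\<in>Poly_Mapping.keys m. h i ^ Poly_Mapping.lookup m i))"
  unfolding subst_hom_def using assms by (intro sum.mono_neutral_left) (auto simp: in_keys_iff)

lemma subst_hom_add: "subst_hom h (f + g) = subst_hom h f + subst_hom h g"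
proof -
  let ?A = "Poly_Mapping.keys f \<union> Poly_Mapping.keys g"
  show ?thesis
    using keys_add[of f g]
    by (simp add: subst_hom_superset[of ?A] lookup_add single_add distrib_right sum.distrib)
qed

lemma subst_hom_sum: "finite I \<Longrightarrow> subst_hom h (sum F I) = (\<Sum>i\<in>I. subst_hom h (F i))"
  by (induction I rule: finite_induct) (auto simp: subst_hom_add, simp add: subst_hom_def)

lemma mono_superset:
  assumes "finite A" "Poly_Mapping.keys m \<subseteq> A"
  shows "(\<Prod>i\<in>Poly_Mapping.keys m. (h i :: 'a::comm_monoid_mult) ^ Poly_Mapping.lookup m i)
    = (\<Prod>i\<in>A. h i ^ Poly_Mapping.lookup m i)"
  using assms by (intro prod.mono_neutral_left) (auto simp: in_keys_iff)

lemma mono_add: "(\<Prod>i\<in>Poly_Mapping.keys (m+n). (h i :: 'a::comm_monoid_mult) ^ Poly_Mapping.lookup (m+n) i)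
  = (\<Prod>i\<in>Poly_Mapping.keys m. h i ^ Poly_Mapping.lookup m i) * (\<Prod>i\<in>Poly_Mapping.keys n. h i ^ Poly_Mapping.lookup n i)"
proof -
  let ?A = "Poly_Mapping.keys m \<union> Poly_Mapping.keys n"
  show ?thesis
    unfolding mono_superset[OF finite_UnI[OF finite_keys finite_keys] keys_add, of h m n]
      mono_superset[of ?A m, OF finite_UnI[OF finite_keys finite_keys] Un_upper1]
      mono_superset[of ?A n, OF finite_UnI[OF finite_keys finite_keys] Un_upper2]
    by (simp add: lookup_add power_add prod.distrib)
qed

lemma subst_hom_single: "subst_hom h (Poly_Mapping.single m c) = Poly_Mapping.single 0 c *
    (\<Prod>i\<in>Poly_Mapping.keys m. h i ^ Poly_Mapping.lookup m i)"
  by (subst subst_hom_superset[of "{m}"]) (auto)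

lemma subst_hom_mult: "subst_hom h (f * g) = subst_hom h f * subst_hom h g"
proof -
  have 1: "subst_hom h (Poly_Mapping.single m c * Poly_Mapping.single n c') =
     subst_hom h (Poly_Mapping.single m c) * subst_hom h (Poly_Mapping.single n c')" for m n c c'
    by (simp add: mult_single subst_hom_single mono_add mult_ac)
       (metis (no_types) add_0 mult.assoc mult_single)
  have e: "f * g = (\<Sum>m\<in>Poly_Mapping.keys f. \<Sum>n\<in>Poly_Mapping.keys g. Poly_Mapping.single m (Poly_Mapping.lookup f m) * Poly_Mapping.single n (Poly_Mapping.lookup g n))"
    by (subst (1) pm_expand[of f], subst (1) pm_expand[of g]) (simp add: sum_product)
  have F: "subst_hom h p = (\<Sum>m\<in>Poly_Mapping.keys p. subst_hom h (Poly_Mapping.single m (Poly_Mapping.lookup p m)))" for p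
    unfolding subst_hom_single by (simp only: subst_hom_def)
  show ?thesis
    unfolding e F[of f] F[of g] by (simp only: subst_hom_sum finite_keys 1 sum_product)
qed

lemma phi_X: "\<phi> a d (X i) = Poly_Mapping.single (a + nscale (i - 1) d) 1"
  by (simp add: \<phi>_def X_def subst_hom_single)

lemma phi_const: "\<phi> a d (Poly_Mapping.single 0 c) = Poly_Mapping.single 0 c"
  by (simp add: \<phi>_def subst_hom_single)

lemma tdeg_superset: "finite A \<Longrightarrow> Poly_Mapping.keys m \<subseteq> A \<Longrightarrow> tdeg m = sum (Poly_Mapping.lookup m) A"
  unfolding tdeg_def by (intro sum.mono_neutral_left) (auto simp: in_keys_iff)

lemma tdeg_add: "tdeg (m + n) = tdeg m + tdeg n"
proof -
  let ?A = "Poly_Mapping.keys m \<union> Poly_Mapping.keys n"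
  show ?thesis
    using keys_add[of m n]
    by (simp add: tdeg_superset[of ?A] lookup_add sum.distrib)
qed

lemma grevlex_irrefl: "\<not> grevlex m m" by (simp add: grevlex_def)

lemma grevlex_trans:
  assumes "grevlex m n" "grevlex n p"
  shows "grevlex m p"
proof (cases "tdeg m = tdeg n \<and> tdeg n = tdeg p")
  case True
  then have "\<not> tdeg m < tdeg n" "\<not> tdeg n < tdeg p" by linarith+
  with assms obtain i j where
    i: "Poly_Mapping.lookup n i < Poly_Mapping.lookup m i"
       "\<forall>l>i. Poly_Mapping.lookup m l = Poly_Mapping.lookup n l" and
    j: "Poly_Mapping.lookup p j < Poly_Mapping.lookup n j"
       "\<forall>l>j. Poly_Mapping.lookup n l = Poly_Mapping.lookup p l"
    unfolding grevlex_def by blast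
  define l where "l = max i j"
  have "Poly_Mapping.lookup p l < Poly_Mapping.lookup m l"
  proof (cases i j rule: linorder_cases)
    case less
    then have "Poly_Mapping.lookup m j = Poly_Mapping.lookup n j" "l = j"
      using i(2) by (blast, simp add: l_def)
    then show ?thesis using j(1) by metis
  next
    case equal
    then have "l = i" "j = i" by (simp_all add: l_def)
    then show ?thesis using i(1) j(1) by (metis less_trans)
  next
    case greater
    then have "Poly_Mapping.lookup n i = Poly_Mapping.lookup p i" "l = i"
      using j(2) by (blast, simp add: l_def)
    then show ?thesis using i(1) by metis
  qed
  moreover have "\<forall>l'>l. Poly_Mapping.lookup m l' = Poly_Mapping.lookup p l'"
  proof (intro allI impI)
    fix l' assume "l' > l"
    then have "i < l'" "j < l'" by (simp_all add: l_def)
    then have "Poly_Mapping.lookup m l' = Poly_Mapping.lookup n l'"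
      "Poly_Mapping.lookup n l' = Poly_Mapping.lookup p l'" using i(2) j(2) by blast+
    then show "Poly_Mapping.lookup m l' = Poly_Mapping.lookup p l'" by (rule trans)
  qed
  moreover have "tdeg m = tdeg p" using True by (metis (no_types))
  ultimately show ?thesis unfolding grevlex_def by blast
next
  case False
  moreover have "tdeg m \<le> tdeg n" "tdeg n \<le> tdeg p"
    using assms unfolding grevlex_def by linarith+
  ultimately have "tdeg m < tdeg p" by linarith
  then show ?thesis unfolding grevlex_def by blast
qed

lemma grevlex_total:
  assumes "m \<noteq> n"
  shows "grevlex m n \<or> grevlex n m"
proof -
  let ?D = "{i. Poly_Mapping.lookup m i \<noteq> Poly_Mapping.lookup n i}"
  have "?D \<subseteq> Poly_Mapping.keys m \<union> Poly_Mapping.keys n" by (auto simp: in_keys_iff)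
  then have fin: "finite ?D" by (rule finite_subset) simp
  have ne: "?D \<noteq> {}" using assms poly_mapping_eqI[of m n] by blast
  define i where "i = Max ?D"
  have "i \<in> ?D" unfolding i_def using fin ne by (rule Max_in)
  then have 1: "Poly_Mapping.lookup m i < Poly_Mapping.lookup n i \<or>
      Poly_Mapping.lookup n i < Poly_Mapping.lookup m i"
    unfolding mem_Collect_eq by (rule linorder_neqE_nat) blast+
  have 2: "\<forall>j>i. Poly_Mapping.lookup m j = Poly_Mapping.lookup n j"
  proof (intro allI impI, rule ccontr)
    fix j assume "i < j" "Poly_Mapping.lookup m j \<noteq> Poly_Mapping.lookup n j"
    then have "j \<le> i" unfolding i_def by (intro Max_ge[OF fin]) blast
    with \<open>i < j\<close> show False by linarith
  qed
  then have 3: "\<forall>j>i. Poly_Mapping.lookup n j = Poly_Mapping.lookup m j" by metis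
  consider "tdeg m < tdeg n" | "tdeg n < tdeg m" | "tdeg m = tdeg n" "tdeg n = tdeg m" by linarith
  then show ?thesis
    by cases (use 1 2 3 in \<open>unfold grevlex_def, blast+\<close>)
qed

lemma grevlex_add:
  assumes "grevlex m n"
  shows "grevlex (m + p) (n + p)"
  using assms unfolding grevlex_def tdeg_add lookup_add add_less_cancel_right add_right_cancel .

lemma grevlex_zero:
  assumes "m \<noteq> 0"
  shows "grevlex 0 m"
proof -
  obtain i where "Poly_Mapping.lookup m i \<noteq> 0"
    using assms poly_mapping_eqI[of m 0] by auto
  then have "i \<in> Poly_Mapping.keys m" "0 < Poly_Mapping.lookup m i"
    by (simp_all add: in_keys_iff)
  then have "0 < tdeg m"
    unfolding tdeg_def by (intro sum_pos2[of _ i]) simp_all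
  then show ?thesis by (simp add: grevlex_def tdeg_def)
qed

lemma affine_semigroup_zero: "0 \<in> affine_semigroup A"
proof -
  have "(0 :: nat \<times> nat) = (\<Sum>v\<in>A. nscale 0 v)"
    by (rule sum.neutral [symmetric]) (simp add: nscale_def zero_prod_def)
  then show ?thesis
    unfolding affine_semigroup_def by (intro CollectI exI[of _ "\<lambda>_. 0"]) simp
qed

lemma affine_semigroup_add:
  assumes "x \<in> affine_semigroup A" "y \<in> affine_semigroup A"
  shows "x + y \<in> affine_semigroup A"
proof -
  obtain c c' where "x = (\<Sum>v\<in>A. nscale (c v) v)" "y = (\<Sum>v\<in>A. nscale (c' v) v)"
    using assms unfolding affine_semigroup_def by blast
  moreover have "nscale (m + n) v = nscale m v + nscale n v" for m n v
    by (simp add: nscale_def algebra_simps)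
  ultimately have "x + y = (\<Sum>v\<in>A. nscale (c v + c' v) v)"
    by (simp add: sum.distrib)
  then show ?thesis
    unfolding affine_semigroup_def by (intro CollectI exI[of _ "\<lambda>v. c v + c' v"]) simp
qed

lemma affine_semigroup_base:
  assumes "finite A" "g \<in> A"
  shows "g \<in> affine_semigroup A"
proof -
  have "(\<Sum>v\<in>A. nscale (if v = g then 1 else 0) v) = (\<Sum>v\<in>A. if v = g then v else 0)"
    by (rule sum.cong) (auto simp: nscale_def zero_prod_def)
  also have "\<dots> = g" using assms by simp
  finally show ?thesis
    unfolding affine_semigroup_def by (intro CollectI exI[of _ "\<lambda>v. if v = g then 1 else 0"]) simp
qed

lemma cring_K_S: "cring (semigroup_ring (S_adk a d k) :: ((nat \<times> nat) \<Rightarrow>\<^sub>0 'k::field) ring)"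
  unfolding S_adk_def by (intro semigroup_ring_cring affine_semigroup_zero affine_semigroup_add)

lemma cring_poly_ring: "cring (poly_ring n :: ((nat \<Rightarrow>\<^sub>0 nat) \<Rightarrow>\<^sub>0 'k::field) ring)"
proof (rule semigroup_ring_cring)
  fix x y assume "x \<in> exponents n" "y \<in> exponents n"
  then show "x + y \<in> exponents n"
    using keys_add[of x y] unfolding exponents_def by blast
qed (simp add: exponents_def)

lemma phi_hom:
  "\<phi> a d \<in> ring_hom (poly_ring (k + 1)) (semigroup_ring (S_adk a d k) :: ((nat \<times> nat) \<Rightarrow>\<^sub>0 'k::field) ring)"
proof -
  let ?S = "S_adk a d k"
  have add: "Poly_Mapping.keys (f + g) \<subseteq> ?S"
    if "Poly_Mapping.keys f \<subseteq> ?S" "Poly_Mapping.keys g \<subseteq> ?S" for f g :: "(nat \<times> nat) \<Rightarrow>\<^sub>0 'k"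
    using keys_add[of f g] that by blast
  have mult: "Poly_Mapping.keys (f * g) \<subseteq> ?S"
    if "Poly_Mapping.keys f \<subseteq> ?S" "Poly_Mapping.keys g \<subseteq> ?S" for f g :: "(nat \<times> nat) \<Rightarrow>\<^sub>0 'k"
    using keys_mult[of f g] that affine_semigroup_add unfolding S_adk_def by blast
  have zero: "0 \<in> ?S" unfolding S_adk_def by (rule affine_semigroup_zero)
  have pow: "Poly_Mapping.keys (f ^ n) \<subseteq> ?S"
    if "Poly_Mapping.keys f \<subseteq> ?S" for f :: "(nat \<times> nat) \<Rightarrow>\<^sub>0 'k" and n
    by (induction n) (use that zero mult in simp_all)
  have prod: "Poly_Mapping.keys (prod F I) \<subseteq> ?S"
    if "finite I" "\<And>i. i \<in> I \<Longrightarrow> Poly_Mapping.keys (F i) \<subseteq> ?S" for F :: "nat \<Rightarrow> (nat \<times> nat) \<Rightarrow>\<^sub>0 'k" and I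
    using that by (induction I rule: finite_induct) (use zero mult in simp_all)
  have gen: "a + nscale (i - 1) d \<in> ?S" if "i \<in> {1..k + 1}" for i
    unfolding S_adk_def generators_def using that by (intro affine_semigroup_base) auto
  have "Poly_Mapping.keys (\<phi> a d f) \<subseteq> ?S"
    if "Poly_Mapping.keys f \<subseteq> exponents (k + 1)" for f :: "(nat \<Rightarrow>\<^sub>0 nat) \<Rightarrow>\<^sub>0 'k"
  proof -
    have "Poly_Mapping.keys (Poly_Mapping.single 0 (Poly_Mapping.lookup f m) *
       (\<Prod>i\<in>Poly_Mapping.keys m. Poly_Mapping.single (a + nscale (i - 1) d) (1::'k) ^ Poly_Mapping.lookup m i)) \<subseteq> ?S"
      if "m \<in> Poly_Mapping.keys f" for m
    proof (intro mult prod pow)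
      fix i assume "i \<in> Poly_Mapping.keys m"
      then have "i \<in> {1..k + 1}"
        using that \<open>Poly_Mapping.keys f \<subseteq> exponents (k + 1)\<close> unfolding exponents_def by blast
      from gen[OF this] show "Poly_Mapping.keys (Poly_Mapping.single (a + nscale (i - 1) d) (1::'k)) \<subseteq> ?S"
        by simp
    qed (use zero in auto)
    then show ?thesis
      unfolding \<phi>_def subst_hom_def by (intro order_trans[OF keys_sum] UN_least)
  qed
  moreover have "\<phi> a d (1 :: (nat \<Rightarrow>\<^sub>0 nat) \<Rightarrow>\<^sub>0 'k) = 1"
    using phi_const[of a d "1::'k"] by simp
  ultimately show ?thesis
    by (intro ring_hom_memI) (auto simp: semigroup_ring_def \<phi>_def subst_hom_add subst_hom_mult)
qed

lemma ideal_defining_ideal: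
  "ideal (defining_ideal a d k :: ((nat \<Rightarrow>\<^sub>0 nat) \<Rightarrow>\<^sub>0 'k::field) set) (poly_ring (k + 1))"
  unfolding defining_ideal_def
  by (intro ring_hom_ring.kernel_is_ideal ring_hom_ringI2 phi_hom cring.axioms(1) cring_K_S cring_poly_ring)

lemma lead_monomial_props:
  assumes "f \<noteq> 0"
  shows "lead_monomial grevlex f \<in> Poly_Mapping.keys f"
    and "\<And>n. n \<in> Poly_Mapping.keys f \<Longrightarrow> n \<noteq> lead_monomial grevlex f \<Longrightarrow> grevlex n (lead_monomial grevlex f)"
proof -
  let ?P = "\<lambda>A m. m \<in> A \<and> (\<forall>n\<in>A. n \<noteq> m \<longrightarrow> grevlex n m)"
  have ex: "\<exists>m. ?P A m" if "finite A" "A \<noteq> {}" for A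
    using that
  proof (induction A rule: finite_ne_induct)
    case (insert x F)
    then obtain m where m: "?P F m" by blast
    show ?case
    proof (cases "grevlex m x")
      case True
      then have "?P (insert x F) x" using m True by (auto intro: grevlex_trans)
      then show ?thesis by blast
    next
      case False
      then have "grevlex x m" using grevlex_total[of x m] m insert.hyps by auto
      then have "?P (insert x F) m" using m by blast
      then show ?thesis by blast
    qed
  qed auto
  have "Poly_Mapping.keys f \<noteq> {}"
  proof
    assume "Poly_Mapping.keys f = {}"
    then have "f = 0" by (intro poly_mapping_eqI) (auto simp: in_keys_iff set_eq_iff)
    with assms show False by simp
  qed
  then obtain m where m: "?P (Poly_Mapping.keys f) m"
    using ex[OF finite_keys] by blast
  have "m' = m" if m': "?P (Poly_Mapping.keys f) m'" for m'
  proof (rule ccontr)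
    assume "m' \<noteq> m"
    then have "grevlex m' m" "grevlex m m'" using m m' by auto
    then show False using grevlex_trans grevlex_irrefl by blast
  qed
  with m have "?P (Poly_Mapping.keys f) (lead_monomial grevlex f)"
    unfolding lead_monomial_def by (rule theI)
  then show "lead_monomial grevlex f \<in> Poly_Mapping.keys f"
    and "\<And>n. n \<in> Poly_Mapping.keys f \<Longrightarrow> n \<noteq> lead_monomial grevlex f \<Longrightarrow> grevlex n (lead_monomial grevlex f)"
    by blast+
qed

end

theory Submission
  imports Defs
begin

text \<open>
  Write \<open>w(m) = \<Sum>\<^sub>i (i - 1) m\<^sub>i\<close> for the weight of the monomial with exponent vector \<open>m\<close>. The
  substitution \<open>x\<^sub>i \<mapsto> t\<^bsup>a + (i-1)d\<^esup>\<close> sends this monomial to \<open>t\<^bsup>deg(m) a + w(m) d\<^esup>\<close>. As \<open>a\<close> and \<open>d\<close>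
  are independent, two monomials have the same image iff they agree in degree and weight
  (\<open>degree_weight_unique\<close>).

  The set \<open>G\<close> consists of one binomial for each product \<open>x\<^sub>p x\<^sub>q\<close> of two inner variables
  (\<open>2 \<le> p \<le> q \<le> k\<close>). It moves the two indices apart, keeping their sum, until one of
  them reaches an end of \<open>{1..k+1}\<close> (\<open>xi_Union\<close>). The larger index grows in the process,
  so the leading term in the reverse lexicographic order is \<open>x\<^sub>p x\<^sub>q\<close> (\<open>LT_spread\<close>).

  It remains to see that the leading monomial \<open>m\<close> of a non-zero element \<open>f\<close> of the ideal is divisible
  by some \<open>x\<^sub>p x\<^sub>q\<close>. Since \<open>f\<close> maps to \<open>0\<close>, the term at \<open>m\<close> has to cancel against another term
  of \<open>f\<close> with the same image, at a monomial smaller than \<open>m\<close> (\<open>kernel_partner\<close>). But a monomial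
  with at most one inner variable, to the first power, is the smallest one of its degree and weight
  (\<open>grevlex_least_of_weight\<close>): it already has as much of its weight as possible in \<open>x\<^bsub>k+1\<^esub>\<close>, and the
  remainder, which is less than \<open>k\<close>, in a single variable.
\<close>

section \<open>Degree and weight\<close>

definition weight :: "(nat \<Rightarrow>\<^sub>0 nat) \<Rightarrow> nat"
  where "weight m = (\<Sum>i\<in>Poly_Mapping.keys m. Poly_Mapping.lookup m i * (i - 1))"

lemma weight_superset:
  assumes "finite A" "Poly_Mapping.keys m \<subseteq> A"
  shows "weight m = (\<Sum>i\<in>A. Poly_Mapping.lookup m i * (i - 1))"
  unfolding weight_def using assms by (intro sum.mono_neutral_left) (auto simp: in_keys_iff)

lemma single_power: "Poly_Mapping.single v (1::'k::field) ^ n = Poly_Mapping.single (nscale n v) 1"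
  by (induction n) (auto simp: mult_single nscale_def zero_prod_def plus_prod_def simp flip: single_one)

lemma prod_single:
  "finite A \<Longrightarrow> (\<Prod>i\<in>A. Poly_Mapping.single (h i) (1::'k::field)) = Poly_Mapping.single (sum h A) 1"
  by (induction A rule: finite_induct) (auto simp: mult_single)

lemma phi_single:
  "\<phi> a d (Poly_Mapping.single m c) =
    Poly_Mapping.single (nscale (tdeg m) a + nscale (weight m) d) (c::'k::field)"
proof -
  have "(\<Sum>i\<in>A. nscale (f i) (a + nscale (g i) d)) =
      nscale (sum f A) a + nscale (\<Sum>i\<in>A. f i * g i) d" if "finite A" for A and f g :: "nat \<Rightarrow> nat"
    using that by (induction A rule: finite_induct)
      (auto simp: nscale_def zero_prod_def plus_prod_def algebra_simps)
  then show ?thesis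
    by (simp add: \<phi>_def subst_hom_single single_power prod_single mult_single tdeg_def weight_def)
qed

lemma phi_diff: "\<phi> a d (f - g) = \<phi> a d f - (\<phi> a d g :: _ \<Rightarrow>\<^sub>0 'k::field)"
proof -
  have "\<phi> a d f = \<phi> a d (f - g) + \<phi> a d g"
    unfolding \<phi>_def subst_hom_add[symmetric] by simp
  then show ?thesis by simp
qed

lemma degree_weight_unique:
  assumes "lin_indep_rat a d" "nscale p a + nscale q d = nscale p' a + nscale q' d"
  shows "p = p' \<and> q = q'"
proof -
  let ?P = "of_nat p - of_nat p' :: rat" and ?Q = "of_nat q - of_nat q' :: rat"
  have "p * fst a + q * fst d = p' * fst a + q' * fst d"
    "p * snd a + q * snd d = p' * snd a + q' * snd d"
    using assms(2) by (auto simp: nscale_def prod_eq_iff)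
  then have "of_nat (p * fst a + q * fst d) = (of_nat (p' * fst a + q' * fst d) :: rat)"
    "of_nat (p * snd a + q * snd d) = (of_nat (p' * snd a + q' * snd d) :: rat)"
    by (simp_all only:)
  then have "?P * of_nat (fst a) + ?Q * of_nat (fst d) = 0"
    "?P * of_nat (snd a) + ?Q * of_nat (snd d) = 0"
    by (simp_all add: algebra_simps)
  then have "?P = 0 \<and> ?Q = 0"
    using assms(1) unfolding lin_indep_rat_def by blast
  then show ?thesis by simp
qed

text \<open>The coefficient of \<open>\<phi> f\<close> at the image of \<open>m\<close> is the sum of the coefficients of \<open>f\<close> at the
  monomials with that image. It vanishes, so the one at \<open>m\<close> cannot be the only non-zero summand.\<close>

lemma kernel_partner:
  fixes f :: "(nat \<Rightarrow>\<^sub>0 nat) \<Rightarrow>\<^sub>0 'k::field"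
  assumes indep: "lin_indep_rat a d" and ker: "\<phi> a d f = 0" and m: "m \<in> Poly_Mapping.keys f"
  obtains n where "n \<in> Poly_Mapping.keys f" "n \<noteq> m" "tdeg n = tdeg m" "weight n = weight m"
proof (rule ccontr)
  let ?v = "\<lambda>n. nscale (tdeg n) a + nscale (weight n) d"
  assume "\<not> thesis"
  with that degree_weight_unique[OF indep]
  have other: "?v n \<noteq> ?v m" if "n \<in> Poly_Mapping.keys f" "n \<noteq> m" for n
    using \<open>n \<in> _\<close> \<open>n \<noteq> m\<close> by blast
  have "\<phi> a d f = \<phi> a d (\<Sum>n\<in>Poly_Mapping.keys f. Poly_Mapping.single n (Poly_Mapping.lookup f n))"
    using pm_expand[of f] by simp
  also have "\<dots> =
      (\<Sum>n\<in>Poly_Mapping.keys f. \<phi> a d (Poly_Mapping.single n (Poly_Mapping.lookup f n)))"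
    unfolding \<phi>_def by (rule subst_hom_sum[OF finite_keys])
  finally have "Poly_Mapping.lookup (\<phi> a d f) (?v m) =
      (\<Sum>n\<in>Poly_Mapping.keys f. Poly_Mapping.lookup f n when ?v n = ?v m)"
    by (simp only: phi_single lookup_sum lookup_single)
  then have "0 = (\<Sum>n\<in>Poly_Mapping.keys f. Poly_Mapping.lookup f n when ?v n = ?v m)"
    unfolding ker by simp
  also have "\<dots> = (\<Sum>n\<in>Poly_Mapping.keys f. if n = m then Poly_Mapping.lookup f n else 0)"
    by (rule sum.cong) (use other in \<open>auto simp: when_def\<close>)
  also have "\<dots> = Poly_Mapping.lookup f m" using m by simp
  finally show False using m by (simp add: in_keys_iff)
qed

section \<open>Monomials with at most one inner variable\<close>

lemma split_off_variable:
  assumes "Poly_Mapping.lookup m p > 0"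
  shows "m = Poly_Mapping.single p 1 + (m - Poly_Mapping.single p (1::nat))"
  using assms by (intro poly_mapping_eqI) (auto simp: lookup_add lookup_minus lookup_single when_def)

lemma two_inner_variables:
  fixes m :: "nat \<Rightarrow>\<^sub>0 nat"
  assumes "(\<Sum>l=2..k. Poly_Mapping.lookup m l) > 1"
  obtains p q r where "2 \<le> p" "p \<le> q" "q \<le> k"
    "m = Poly_Mapping.single p 1 + Poly_Mapping.single q 1 + r"
proof -
  have pos: "\<exists>p\<in>{2..k}. Poly_Mapping.lookup n p > 0"
    if "(\<Sum>l=2..k. Poly_Mapping.lookup n l) > 0" for n :: "nat \<Rightarrow>\<^sub>0 nat"
    using that by (metis gr0I less_irrefl sum.neutral)
  obtain p where p: "p \<in> {2..k}" "Poly_Mapping.lookup m p > 0"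
    using pos[of m] assms by auto
  define m' where "m' = m - Poly_Mapping.single p (1::nat)"
  have m: "m = Poly_Mapping.single p 1 + m'"
    unfolding m'_def using split_off_variable[OF p(2)] .
  have "(\<Sum>l=2..k. Poly_Mapping.lookup m l) = 1 + (\<Sum>l=2..k. Poly_Mapping.lookup m' l)"
    using p(1) by (subst m) (simp add: lookup_add sum.distrib lookup_single when_def)
  with assms obtain q where q: "q \<in> {2..k}" "Poly_Mapping.lookup m' q > 0"
    using pos[of m'] by auto
  define r where "r = m' - Poly_Mapping.single q (1::nat)"
  have "m' = Poly_Mapping.single q 1 + r"
    unfolding r_def using split_off_variable[OF q(2)] .
  with m have "m = Poly_Mapping.single p 1 + Poly_Mapping.single q 1 + r"
    "m = Poly_Mapping.single q 1 + Poly_Mapping.single p 1 + r"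
    by (simp_all add: ac_simps)
  with that[of p q r] that[of q p r] p(1) q(1) show thesis
    by (cases "p \<le> q") auto
qed

text \<open>A smaller monomial \<open>n\<close> of the same degree has a larger exponent than \<open>m\<close> at some \<open>x\<^sub>i\<close> and the
  same exponents above. Equality of degrees excludes \<open>i = 1\<close>. For \<open>i \<ge> 2\<close> the variables below \<open>x\<^sub>i\<close>
  carry total weight at most \<open>i - 2\<close> in \<open>m\<close>, as \<open>x\<^sub>1\<close> has weight \<open>0\<close> and at most one of the others
  occurs, to the first power. This is less than the weight \<open>i - 1\<close> that \<open>n\<close> gains at \<open>x\<^sub>i\<close>.\<close>

lemma grevlex_least_of_weight:
  assumes m: "m \<in> exponents (k + 1)" and n: "n \<in> exponents (k + 1)"
    and inner: "(\<Sum>l=2..k. Poly_Mapping.lookup m l) \<le> 1"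
    and deg: "tdeg n = tdeg m" and wt: "weight n = weight m"
  shows "\<not> grevlex n m"
proof
  assume "grevlex n m"
  with deg obtain i where i: "Poly_Mapping.lookup m i < Poly_Mapping.lookup n i"
    and above: "\<forall>j>i. Poly_Mapping.lookup n j = Poly_Mapping.lookup m j"
    unfolding grevlex_def by auto
  have "i \<in> Poly_Mapping.keys n" using i by (simp add: in_keys_iff)
  with n have ik: "1 \<le> i" "i \<le> k + 1" unfolding exponents_def by auto
  \<comment> \<open>Sums over the variables are cut at the last exponent that differs.\<close>
  have cut: "sum g {1..k+1} = sum g {1..<i} + g i + sum g {i<..k+1}" for g :: "nat \<Rightarrow> nat"
  proof -
    have "{1..k+1} = {1..<i} \<union> ({i} \<union> {i<..k+1})" using ik by auto
    then show ?thesis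
      by (simp only:) (subst sum.union_disjoint, auto)+
  qed
  have tail: "(\<Sum>l\<in>{i<..k+1}. h (Poly_Mapping.lookup n l) l) =
      (\<Sum>l\<in>{i<..k+1}. h (Poly_Mapping.lookup m l) l)" for h :: "nat \<Rightarrow> nat \<Rightarrow> nat"
    using above by (intro sum.cong) auto
  have deg': "sum (Poly_Mapping.lookup n) {1..<i} + Poly_Mapping.lookup n i =
      sum (Poly_Mapping.lookup m) {1..<i} + Poly_Mapping.lookup m i"
    using deg m n tail[of "\<lambda>x _. x"]
    by (simp only: tdeg_superset[of "{1..k+1}"] exponents_def mem_Collect_eq cut finite_atLeastAtMost)
  have wt': "(\<Sum>l=1..<i. Poly_Mapping.lookup n l * (l - 1)) + Poly_Mapping.lookup n i * (i - 1) =
      (\<Sum>l=1..<i. Poly_Mapping.lookup m l * (l - 1)) + Poly_Mapping.lookup m i * (i - 1)"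
    using wt m n tail[of "\<lambda>x l. x * (l - 1)"]
    by (simp only: weight_superset[of "{1..k+1}"] exponents_def mem_Collect_eq cut finite_atLeastAtMost)
  show False
  proof (cases "i = 1")
    case True
    with deg' i show False by simp
  next
    case False
    have "(\<Sum>l=1..<i. Poly_Mapping.lookup m l * (l - 1)) =
        (\<Sum>l=2..<i. Poly_Mapping.lookup m l * (l - 1))"
      by (rule sum.mono_neutral_right) auto
    also have "\<dots> \<le> (\<Sum>l=2..<i. Poly_Mapping.lookup m l * (i - 2))"
      by (intro sum_mono mult_le_mono) auto
    also have "\<dots> = (\<Sum>l=2..<i. Poly_Mapping.lookup m l) * (i - 2)"
      by (simp add: sum_distrib_right)
    also have "(\<Sum>l=2..<i. Poly_Mapping.lookup m l) \<le> (\<Sum>l=2..k. Poly_Mapping.lookup m l)"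
      using ik by (intro sum_mono2) auto
    also have "\<dots> \<le> 1" by (rule inner)
    finally have "(\<Sum>l=1..<i. Poly_Mapping.lookup m l * (l - 1)) < i - 1"
      using False ik by simp
    moreover have "(Poly_Mapping.lookup m i + 1) * (i - 1) \<le> Poly_Mapping.lookup n i * (i - 1)"
      using i by (intro mult_le_mono1) auto
    ultimately show False using wt' by (simp add: algebra_simps)
  qed
qed

section \<open>The binomials and their leading terms\<close>

text \<open>The pair \<open>(p - j, q + j)\<close> for the first \<open>j\<close> at which the left index is \<open>1\<close> or the right one is
  \<open>k + 1\<close>; the left end is reached first, or at the same time, iff \<open>p - 1 \<le> k + 1 - q\<close>.\<close>

definition spread :: "nat \<Rightarrow> nat \<Rightarrow> nat \<Rightarrow> nat \<times> nat"
  where "spread k p q =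
    (if p + q \<le> k + 2 then (1, p + q - 1) else (p + q - (k + 1), k + 1))"

definition spread_binomial :: "nat \<Rightarrow> nat \<Rightarrow> nat \<Rightarrow> (nat \<Rightarrow>\<^sub>0 nat) \<Rightarrow>\<^sub>0 'k::field"
  where "spread_binomial k p q =
    X p * X q - X (fst (spread k p q)) * X (snd (spread k p q))"

text \<open>For \<open>p + q = k + 2\<close> both spreading rules give \<open>x\<^sub>1 x\<^bsub>k+1\<^esub>\<close>, so it does not matter on which side of
  the case distinctions this sum is counted.\<close>

lemma xi_eq:
  assumes "2 \<le> l" "l \<le> k"
  shows "xi k l = (spread_binomial k l ` {l..k} :: (_ \<Rightarrow>\<^sub>0 'k::field) set)"
proof -
  have sq: "(X l ^ 2 :: _ \<Rightarrow>\<^sub>0 'k) = X l * X l" by (simp add: power2_eq_square)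
  have shift: "{l..k} = insert l {l + i | i. 1 \<le> i \<and> i \<le> k - l}"
    unfolding set_eq_iff insert_iff mem_Collect_eq atLeastAtMost_iff using assms by presburger
  have img: "g ` {l + i | i. P i} = {g (l + i) | i. P i}" for g :: "nat \<Rightarrow> 'c" and P
    by auto
  show ?thesis
  proof (cases "2 * l > k + 1")
    case True
    have val: "spread_binomial k l (l + i) =
        (X l * X (l + i) - X (2 * l + i - (k + 1)) * X (k + 1) :: _ \<Rightarrow>\<^sub>0 'k)" for i
    proof (cases "l + (l + i) \<le> k + 2")
      case True
      with \<open>2 * l > k + 1\<close> have "l + (l + i) - 1 = k + 1" "2 * l + i - (k + 1) = 1" by auto
      then show ?thesis
        unfolding spread_binomial_def spread_def by (simp only: True if_True fst_conv snd_conv)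
    next
      case False
      then show ?thesis by (simp add: spread_binomial_def spread_def mult_2 add.assoc)
    qed
    have "spread_binomial k l l = (X l * X l - X (2 * l - (k + 1)) * X (k + 1) :: _ \<Rightarrow>\<^sub>0 'k)"
      using val[of 0] by simp
    with True show ?thesis
      unfolding shift image_insert xi_def sq img val by simp
  next
    case False
    have low: "spread_binomial k l (l + i) = (X l * X (l + i) - X 1 * X (2 * l - 1 + i) :: _ \<Rightarrow>\<^sub>0 'k)"
      if "i \<le> k + 2 - 2 * l" for i
    proof -
      have "l + (l + i) \<le> k + 2" "l + (l + i) - 1 = 2 * l - 1 + i" using that False assms by auto
      then show ?thesis
        unfolding spread_binomial_def spread_def by (simp only: if_True fst_conv snd_conv)
    qed
    have high: "spread_binomial k l (l + i) =
        (X l * X (l + i) - X (2 * l + i - (k + 1)) * X (k + 1) :: _ \<Rightarrow>\<^sub>0 'k)"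
      if "k + 2 - 2 * l < i" for i
    proof -
      have "\<not> l + (l + i) \<le> k + 2" "l + (l + i) = 2 * l + i" using that False by auto
      then show ?thesis
        unfolding spread_binomial_def spread_def by (simp only: if_False fst_conv snd_conv)
    qed
    have range: "{l + i | i. 1 \<le> i \<and> i \<le> k - l} =
        {l + i | i. 1 \<le> i \<and> i \<le> k + 2 - 2 * l} \<union> {l + i | i. k + 2 - 2 * l < i \<and> i \<le> k - l}"
      using False assms by auto
    have "spread_binomial k l ` {l..k} =
      {spread_binomial k l l} \<union>
      {spread_binomial k l (l + i) :: _ \<Rightarrow>\<^sub>0 'k | i. 1 \<le> i \<and> i \<le> k + 2 - 2 * l} \<union>
      {spread_binomial k l (l + i) | i. k + 2 - 2 * l < i \<and> i \<le> k - l}"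
      unfolding shift range by (auto simp: img image_Un)
    also have "spread_binomial k l l = (X l ^ 2 - X 1 * X (2 * l - 1) :: _ \<Rightarrow>\<^sub>0 'k)"
      using low[of 0] by (simp add: sq)
    also have "{spread_binomial k l (l + i) :: _ \<Rightarrow>\<^sub>0 'k | i. 1 \<le> i \<and> i \<le> k + 2 - 2 * l} =
      {X l * X (l + i) - X 1 * X (2 * l - 1 + i) | i. 1 \<le> i \<and> i \<le> k + 2 - 2 * l}"
      using low by (intro Collect_cong) metis
    also have "{spread_binomial k l (l + i) :: _ \<Rightarrow>\<^sub>0 'k | i. k + 2 - 2 * l < i \<and> i \<le> k - l} =
      {X l * X (l + i) - X (2 * l + i - (k + 1)) * X (k + 1) | i.
         k + 2 - 2 * l < i \<and> i \<le> k - l}"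
      using high by (intro Collect_cong) metis
    finally show ?thesis using False unfolding xi_def by simp
  qed
qed

lemma xi_Union:
  "(\<Union>l\<in>{2..k}. xi k l) = {spread_binomial k p q | p q. 2 \<le> p \<and> p \<le> q \<and> q \<le> k}"
  by (fastforce simp: xi_eq)

lemma X_mult: "X p * X q =
    Poly_Mapping.single (Poly_Mapping.single p 1 + Poly_Mapping.single q 1) (1::'k::field)"
  by (simp add: X_def mult_single)

lemma LT_binomial:
  assumes "grevlex n m"
  shows "LT grevlex (Poly_Mapping.single m 1 - Poly_Mapping.single n (1::'k::field)) =
    Poly_Mapping.single m 1"
proof -
  let ?f = "Poly_Mapping.single m 1 - Poly_Mapping.single n (1::'k)"
  have ne: "m \<noteq> n" using assms grevlex_irrefl by auto
  have co: "Poly_Mapping.lookup ?f m = 1"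
    using ne by (simp add: lookup_minus lookup_single when_def)
  then have f: "?f \<noteq> 0" and m: "m \<in> Poly_Mapping.keys ?f" by (auto simp: in_keys_iff)
  have "lead_monomial grevlex ?f \<in> {m, n}"
    using lead_monomial_props(1)[OF f]
    by (auto simp: in_keys_iff lookup_minus lookup_single when_def split: if_splits)
  moreover have "lead_monomial grevlex ?f \<noteq> n"
    using lead_monomial_props(2)[OF f m] ne assms grevlex_trans grevlex_irrefl by metis
  ultimately show ?thesis using f co by (simp add: LT_def)
qed

lemma grevlex_pair:
  assumes "q < s" "p \<le> q" "r \<le> s"
  shows "grevlex (Poly_Mapping.single r 1 + Poly_Mapping.single s 1)
    (Poly_Mapping.single p 1 + Poly_Mapping.single q (1::nat))"
proof -
  have "tdeg (Poly_Mapping.single i 1) = 1" for i by (simp add: tdeg_def)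
  then show ?thesis
    using assms unfolding grevlex_def
    by (auto simp: tdeg_add lookup_add lookup_single when_def intro!: exI[of _ s])
qed

lemma spread_bounds:
  assumes "2 \<le> p" "p \<le> q" "q \<le> k"
  shows "1 \<le> fst (spread k p q)" "fst (spread k p q) \<le> snd (spread k p q)"
    "q < snd (spread k p q)" "snd (spread k p q) \<le> k + 1"
    "fst (spread k p q) + snd (spread k p q) = p + q"
  using assms by (auto simp: spread_def)

lemma LT_spread:
  assumes "2 \<le> p" "p \<le> q" "q \<le> k"
  shows "LT grevlex (spread_binomial k p q) = (X p * X q :: _ \<Rightarrow>\<^sub>0 'k::field)"
  unfolding spread_binomial_def X_mult
  by (rule LT_binomial, rule grevlex_pair) (use spread_bounds[OF assms] assms in auto)

lemma X_mult_carrier: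
  assumes "p \<in> {1..n}" "q \<in> {1..n}"
  shows "X p * X q \<in> carrier (poly_ring n)"
proof -
  have "Poly_Mapping.keys (Poly_Mapping.single p 1 + Poly_Mapping.single q (1::nat)) \<subseteq> {p, q}"
    by (rule order_trans[OF keys_add]) auto
  then show ?thesis
    using assms by (auto simp: X_mult semigroup_ring_def exponents_def)
qed

lemma spread_binomial_in_ideal:
  assumes pq: "2 \<le> p" "p \<le> q" "q \<le> k"
  shows "(spread_binomial k p q :: _ \<Rightarrow>\<^sub>0 'k::field) \<in> defining_ideal a d k"
proof -
  let ?r = "fst (spread k p q)" and ?s = "snd (spread k p q)"
  note b = spread_bounds[OF pq]
  have phi: "\<phi> a d (X i * X j) =
      Poly_Mapping.single (nscale 2 a + nscale (i + j - 2) d) (1::'k)"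
    if "1 \<le> i" "1 \<le> j" for i j
  proof -
    have "\<phi> a d (X i * X j) = \<phi> a d (X i) * (\<phi> a d (X j) :: _ \<Rightarrow>\<^sub>0 'k)"
      by (simp add: \<phi>_def subst_hom_mult)
    also have "\<dots> = Poly_Mapping.single ((a + nscale (i - 1) d) + (a + nscale (j - 1) d)) 1"
      by (simp add: phi_X mult_single)
    also have "(a + nscale (i - 1) d) + (a + nscale (j - 1) d) =
        nscale 2 a + nscale ((i - 1) + (j - 1)) d"
      by (simp add: nscale_def prod_eq_iff algebra_simps)
    also have "(i - 1) + (j - 1) = i + j - 2" using that by simp
    finally show ?thesis .
  qed
  have "\<phi> a d (spread_binomial k p q) = (0 :: _ \<Rightarrow>\<^sub>0 'k)"
    unfolding spread_binomial_def phi_diff using pq b phi[of p q] phi[of ?r ?s] by simp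
  moreover have "X p * X q - X ?r * X ?s \<in> carrier (poly_ring (k + 1) :: (_ \<Rightarrow>\<^sub>0 'k) ring)"
  proof -
    have "X p * X q \<in> carrier (poly_ring (k + 1) :: (_ \<Rightarrow>\<^sub>0 'k) ring)"
      "X ?r * X ?s \<in> carrier (poly_ring (k + 1) :: (_ \<Rightarrow>\<^sub>0 'k) ring)"
      by (rule X_mult_carrier; use pq b in auto)+
    then show ?thesis
      using keys_diff[of "X p * X q" "X ?r * X ?s :: _ \<Rightarrow>\<^sub>0 'k"] by (auto simp: semigroup_ring_def)
  qed
  ultimately show ?thesis
    unfolding defining_ideal_def a_kernel_def kernel_def spread_binomial_def
    by (simp add: semigroup_ring_def)
qed

section \<open>The initial ideal\<close>

text \<open>The leading monomial has at least two inner variables: otherwise it would be the smallest of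
  its degree and weight, and no other term of \<open>f\<close> could cancel it.\<close>

lemma lead_monomial_two_inner:
  fixes f :: "(nat \<Rightarrow>\<^sub>0 nat) \<Rightarrow>\<^sub>0 'k::field"
  assumes indep: "lin_indep_rat a d" and f: "f \<in> defining_ideal a d k" "f \<noteq> 0"
  obtains p q r where "2 \<le> p" "p \<le> q" "q \<le> k"
    "lead_monomial grevlex f = Poly_Mapping.single p 1 + Poly_Mapping.single q 1 + r"
proof -
  let ?m = "lead_monomial grevlex f"
  have exps: "Poly_Mapping.keys f \<subseteq> exponents (k + 1)" and ker: "\<phi> a d f = 0"
    using f(1) by (auto simp: defining_ideal_def a_kernel_def kernel_def semigroup_ring_def)
  note lead = lead_monomial_props[OF f(2)]
  obtain n where n: "n \<in> Poly_Mapping.keys f" "n \<noteq> ?m" "tdeg n = tdeg ?m" "weight n = weight ?m"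
    using kernel_partner[OF indep ker lead(1)] .
  have "(\<Sum>l=2..k. Poly_Mapping.lookup ?m l) > 1"
    using grevlex_least_of_weight[of ?m k n] n exps lead(1) lead(2)[OF n(1,2)] by force
  then show thesis using two_inner_variables that by metis
qed

theorem theorem4p7:
  fixes a d :: "nat \<times> nat" and k :: nat
  assumes "k \<ge> 2"
    and "lin_indep_rat a d"
    and "minimal_generating_set (generators a d k) (S_adk a d k)"
  shows "groebner_basis grevlex (k + 1)
    (defining_ideal a d k :: ((nat \<Rightarrow>\<^sub>0 nat) \<Rightarrow>\<^sub>0 'k::field) set)
    (\<Union>l\<in>{2..k}. xi k l)"
proof -
  let ?R = "poly_ring (k + 1) :: ((nat \<Rightarrow>\<^sub>0 nat) \<Rightarrow>\<^sub>0 'k) ring"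
  let ?I = "defining_ideal a d k :: ((nat \<Rightarrow>\<^sub>0 nat) \<Rightarrow>\<^sub>0 'k) set"
  let ?G = "\<Union>l\<in>{2..k}. xi k l :: ((nat \<Rightarrow>\<^sub>0 nat) \<Rightarrow>\<^sub>0 'k) set"
  let ?J = "Idl\<^bsub>?R\<^esub> (LT grevlex ` ?G)"
  have R: "ring ?R" using cring_poly_ring by (rule cring.axioms(1))
  have GI: "?G \<subseteq> ?I" unfolding xi_Union using spread_binomial_in_ideal by blast
  have fin: "finite ?G" by (auto simp: xi_eq)
  have keysI: "Poly_Mapping.keys f \<subseteq> exponents (k + 1)" if "f \<in> ?I" for f
    using that by (auto simp: defining_ideal_def a_kernel_def kernel_def semigroup_ring_def)
  have LT_I: "LT grevlex f \<in> carrier ?R" if "f \<in> ?I" for f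
    using keysI[OF that] lead_monomial_props(1)[of f]
    by (cases "f = 0") (auto simp: LT_def semigroup_ring_def)
  then have sub: "LT grevlex ` ?I \<subseteq> carrier ?R" and subG: "LT grevlex ` ?G \<subseteq> carrier ?R"
    using GI by blast+
  have J: "ideal ?J ?R" by (rule ring.genideal_ideal[OF R subG])
  have "LT grevlex f \<in> ?J" if f: "f \<in> ?I" for f
  proof (cases "f = 0")
    case True
    then show ?thesis
      using additive_subgroup.zero_closed[OF ideal.axioms(1)[OF J]]
      by (simp add: LT_def semigroup_ring_def)
  next
    case False
    let ?c = "Poly_Mapping.lookup f (lead_monomial grevlex f)"
    obtain p q r where pq: "2 \<le> p" "p \<le> q" "q \<le> k"
      and m: "lead_monomial grevlex f = Poly_Mapping.single p 1 + Poly_Mapping.single q 1 + r"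
      using lead_monomial_two_inner[OF assms(2) f False] .
    have "X p * X q \<in> ?J"
    proof -
      have "spread_binomial k p q \<in> ?G" unfolding xi_Union using pq by blast
      then have "LT grevlex (spread_binomial k p q) \<in> LT grevlex ` ?G" by (rule imageI)
      then show ?thesis
        using ring.genideal_self[OF R subG] LT_spread[OF pq, where ?'k = 'k] by auto
    qed
    moreover have "Poly_Mapping.single r ?c \<in> carrier ?R"
    proof -
      have "Poly_Mapping.keys r \<subseteq> Poly_Mapping.keys (lead_monomial grevlex f)"
        unfolding m by (auto simp: in_keys_iff lookup_add)
      then show ?thesis
        using keysI[OF f] lead_monomial_props(1)[OF False]
        by (auto simp: semigroup_ring_def exponents_def)
    qed
    ultimately have "X p * X q \<otimes>\<^bsub>?R\<^esub> Poly_Mapping.single r ?c \<in> ?J"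
      by (rule ideal.I_r_closed[OF J])
    moreover have "LT grevlex f = X p * X q \<otimes>\<^bsub>?R\<^esub> Poly_Mapping.single r ?c"
      using False by (simp add: LT_def X_mult semigroup_ring_def mult_single m)
    ultimately show ?thesis by simp
  qed
  then have "Idl\<^bsub>?R\<^esub> (LT grevlex ` ?I) \<subseteq> ?J"
    by (intro ring.genideal_minimal[OF R] J) blast
  moreover have "?J \<subseteq> Idl\<^bsub>?R\<^esub> (LT grevlex ` ?I)"
    using ring.genideal_self[OF R sub] GI by (intro ring.genideal_minimal[OF R] ring.genideal_ideal[OF R sub]) blast
  ultimately show ?thesis
    unfolding groebner_basis_def using ideal_defining_ideal fin GI by blast
qed

end
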